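(* Let $C$ be a non-empty bounded closed convex subset of a real Banach space $X$ and let $x\in C$ be a strongly extreme point of $C$. Let $\Phi_n:C\to X$, $n=1,2,\ldots$, be a sequence of maps such that each $\Phi_n$ is weak to norm continuous at $x$ and $$\lim_{n}\|\Phi_n x-x\|=0.$$ Suppose that for some $\lambda\in(0,1]$ $$\lim_{n}\lim_{\varepsilon\to0^+}f_n(\varepsilon)=0,$$ where, for $\varepsilon>0$, $$f_n(\varepsilon)=\sup\{\operatorname{dist}((1+\lambda)\Phi_n y-\lambda y,\,C): y\in C,\ \|\Phi_n x-\Phi_n y\|\le\varepsilon\}.$$ Then $x$ is a denting point of $C$.
   Context: Let $B$ be a non-empty bounded closed convex set in a real Banach space $X$ and $x\in B$. $x$ is a strongly extreme point of $B$ if for any sequences $(y_n),(z_n)$ in $B$, $\lim_n\|x-\frac{y_n+z_n}{2}\|=0$ implies $\lim_n\|y_n-z_n\|=0$. A slice of $B$ is a set $S(B,x^*,\delta)=\{y\in B: x^*(y)>\sup_{z\in B}x^*(z)-\delta\}$ with $\delta>0$ and $0\ne x^*\in X^*$. The point $x$ is a denting point of $B$ if for every $\varepsilon>0$ and $\delta>0$ there is a slice $S(B,x^*,\delta)$ of $B$ which contains $x$ and has diameter less than $\varepsilon$. A map $\Phi:B\to X$ is weak to norm continuous at $x$ if it is continuous at $x$ when $B$ carries the relative weak topology of $X$ and the target $X$ carries the norm topology. The maps are not assumed linear. $\operatorname{dist}(u,C)=\inf\{\|u-v\|:v\in C\}$. *)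

theory Defs
  imports "HOL-Analysis.Analysis"
begin

definition strongly_extreme :: "'a::real_normed_vector set \<Rightarrow> 'a \<Rightarrow> bool" where
  "strongly_extreme B x \<longleftrightarrow> x \<in> B \<and>
     (\<forall>y z :: nat \<Rightarrow> 'a. (\<forall>n. y n \<in> B) \<and> (\<forall>n. z n \<in> B) \<and>
        (\<lambda>n. norm (x - (1/2) *\<^sub>R (y n + z n))) \<longlonglongrightarrow> 0 \<longrightarrow>
        (\<lambda>n. norm (y n - z n)) \<longlonglongrightarrow> 0)"

(* The real supremum is the intended one because slices are only used for
   non-empty bounded B. *)
definition slice :: "'a::real_normed_vector set \<Rightarrow> ('a \<Rightarrow>\<^sub>L real) \<Rightarrow> real \<Rightarrow> 'a set" where
  "slice B f \<delta> = {y \<in> B. blinfun_apply f y > (SUP z\<in>B. blinfun_apply f z) - \<delta>}"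

(* In the zero space there is no functional f \<noteq> 0, hence no slice and no denting point. *)
definition denting_point :: "'a::real_normed_vector set \<Rightarrow> 'a \<Rightarrow> bool" where
  "denting_point B x \<longleftrightarrow> x \<in> B \<and>
     (\<forall>\<epsilon>>0. \<forall>\<delta>>0. \<exists>f :: 'a \<Rightarrow>\<^sub>L real.
        f \<noteq> 0 \<and> x \<in> slice B f \<delta> \<and> diameter (slice B f \<delta>) < \<epsilon>)"

(* The coarsest topology making every bounded linear functional continuous. *)
definition weak_topology :: "'a::real_normed_vector topology" where
  "weak_topology =
     topology_generated_by {blinfun_apply f -` U | (f :: 'a \<Rightarrow>\<^sub>L real) U. open U}"

definition weak_to_norm_continuous_at ::
    "'a::real_normed_vector set \<Rightarrow> ('a \<Rightarrow> 'a) \<Rightarrow> 'a \<Rightarrow> bool" where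
  "weak_to_norm_continuous_at B \<Phi> x \<longleftrightarrow>
     topcontinuous_at (subtopology weak_topology B) euclidean \<Phi> x"

(* The function f_n, for a single map \<Phi> = \<Phi>_n and l in place of the reserved symbol \<lambda>. For bounded C containing x and
   \<epsilon> > 0 the supremum is over a non-empty bounded set of reals: \<Phi> y stays within \<epsilon> of
   \<Phi> x and y within the bounded set C. *)
definition dist_sup ::
    "'a::real_normed_vector set \<Rightarrow> real \<Rightarrow> ('a \<Rightarrow> 'a) \<Rightarrow> 'a \<Rightarrow> real \<Rightarrow> real" where
  "dist_sup C l \<Phi> x \<epsilon> =
     (SUP y \<in> {y \<in> C. norm (\<Phi> x - \<Phi> y) \<le> \<epsilon>}.
        infdist ((1 + l) *\<^sub>R \<Phi> y - l *\<^sub>R y) C)"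

end

theory Submission
  imports Defs
begin

text \<open>
  The proof has two halves, both driven by one quantitative form of strong extremality
  (\<open>strongly_extreme_convex_combination\<close>): if \<open>t *\<^sub>R c + (1 - t) *\<^sub>R d\<close> is close to \<open>x\<close>, with \<open>c\<close> and \<open>d\<close>
  in the set and \<open>t\<close> bounded away from \<open>0\<close>, then \<open>c\<close> is close to \<open>x\<close>.

  First, the identity map of \<open>C\<close> is weak to norm continuous at \<open>x\<close>
  (\<open>weak_to_norm_continuous_at_ident\<close>). For a suitable \<open>n\<close> and all \<open>y\<close> in a weak neighbourhood
  of \<open>x\<close> in \<open>C\<close>, the vector \<open>\<Phi> n y\<close> is close to \<open>\<Phi> n x\<close>, hence to \<open>x\<close>, while
  \<open>(1 + l) *\<^sub>R \<Phi> n y - l *\<^sub>R y\<close> is close to a point \<open>c\<close> of \<open>C\<close>. So the convex combination of \<open>y\<close> and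
  \<open>c\<close> with weights \<open>l / (1 + l)\<close> and \<open>1 / (1 + l)\<close> is close to \<open>x\<close>, and therefore \<open>y\<close> is.

  Second, a strongly extreme point at which the identity is weak to norm continuous is denting
  (\<open>strongly_extreme_imp_denting_point\<close>). The part of \<open>C\<close> outside a basic weak neighbourhood of
  \<open>x\<close> is a finite union of convex sets, cut out by half-spaces, each of which has positive distance
  from \<open>x\<close>. By the convex combination estimate the convex hull of their union also has positive
  distance from \<open>x\<close>. A functional that separates \<open>x\<close> from this hull defines a slice that
  contains \<open>x\<close> and lies inside the neighbourhood. Working with distances in this way replaces the
  usual passage to the weak* compact closure of \<open>C\<close> in the bidual.

  The separating functional comes from a Hahn--Banach theorem, obtained here by showing that minimal
  sublinear functionals are linear.
\<close>

section \<open>Linear functionals below sublinear ones\<close>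

text \<open>Homogeneity is required as an inequality only, since the reverse inequality follows by
  scaling back; this halves the work when a functional is defined as an infimum.\<close>

definition sublinear :: "('a::real_vector \<Rightarrow> real) \<Rightarrow> bool" where
  "sublinear q \<longleftrightarrow> (\<forall>u v. q (u + v) \<le> q u + q v) \<and> (\<forall>t>0. \<forall>v. q (t *\<^sub>R v) \<le> t * q v)"

lemma sublinear_add: "sublinear q \<Longrightarrow> q (u + v) \<le> q u + q v"
  by (simp add: sublinear_def)

lemma sublinear_zero:
  assumes "sublinear q" shows "q 0 = 0"
proof -
  have "q (2 *\<^sub>R 0) \<le> 2 * q 0" "q ((1/2) *\<^sub>R 0) \<le> (1/2) * q 0"
    using assms unfolding sublinear_def by (metis zero_less_numeral, metis half_gt_zero zero_less_one)
  then show ?thesis by simp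
qed

lemma sublinear_scale:
  assumes "sublinear q" "0 \<le> t" shows "q (t *\<^sub>R v) = t * q v"
proof (cases "t = 0")
  case False
  then have t: "t > 0" "1 / t > 0" using assms by auto
  have "q ((1 / t) *\<^sub>R (t *\<^sub>R v)) \<le> (1 / t) * q (t *\<^sub>R v)"
    using assms(1) t(2) unfolding sublinear_def by blast
  then have "t * q v \<le> q (t *\<^sub>R v)"
    using t by (simp add: field_simps)
  moreover have "q (t *\<^sub>R v) \<le> t * q v"
    using assms(1) t(1) unfolding sublinear_def by blast
  ultimately show ?thesis by simp
qed (simp add: sublinear_zero[OF assms(1)])

lemma sublinear_lower_bound:
  assumes "sublinear q" shows "- q (- v) \<le> q v"
  using sublinear_add[OF assms, of v "- v"] sublinear_zero[OF assms] by simp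

lemma sublinear_Inf:
  fixes G :: "'a::real_vector \<Rightarrow> real set"
  assumes ne: "\<And>v. G v \<noteq> {}" and bdd: "\<And>v. bdd_below (G v)"
    and add: "\<And>u v a b. a \<in> G u \<Longrightarrow> b \<in> G v \<Longrightarrow> \<exists>c\<in>G (u + v). c \<le> a + b"
    and scale: "\<And>t v a. 0 < t \<Longrightarrow> a \<in> G v \<Longrightarrow> \<exists>c\<in>G (t *\<^sub>R v). c \<le> t * a"
  shows "sublinear (\<lambda>v. Inf (G v))"
  unfolding sublinear_def
proof (intro conjI allI impI)
  fix u v
  have le: "Inf (G (u + v)) \<le> a + b" if "a \<in> G u" "b \<in> G v" for a b
    using add[OF that] cInf_lower[OF _ bdd] by (meson order_trans)
  have "Inf (G (u + v)) - a \<le> Inf (G v)" if "a \<in> G u" for a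
    by (rule cInf_greatest[OF ne]) (use le[OF that] in \<open>simp add: algebra_simps\<close>)
  then have "Inf (G (u + v)) - Inf (G v) \<le> Inf (G u)"
    by (intro cInf_greatest[OF ne]) (simp add: algebra_simps)
  then show "Inf (G (u + v)) \<le> Inf (G u) + Inf (G v)" by simp
next
  fix t :: real and v assume t: "0 < t"
  have "Inf (G (t *\<^sub>R v)) \<le> t * a" if "a \<in> G v" for a
    using scale[OF t that] cInf_lower[OF _ bdd] by (meson order_trans)
  then have "Inf (G (t *\<^sub>R v)) / t \<le> Inf (G v)"
    using t by (intro cInf_greatest[OF ne]) (simp add: field_simps)
  then show "Inf (G (t *\<^sub>R v)) \<le> t * Inf (G v)"
    using t by (simp add: field_simps)
qed

text \<open>Zorn's lemma applies because every sublinear functional below \<open>p\<close> is bounded below by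
  \<open>\<lambda>v. - p (- v)\<close>, so the pointwise infimum of a chain is finite.\<close>

lemma ex_minimal_sublinear:
  assumes p: "sublinear p"
  shows "\<exists>q. sublinear q \<and> (\<forall>v. q v \<le> p v) \<and>
    (\<forall>r. sublinear r \<and> (\<forall>v. r v \<le> q v) \<longrightarrow> r = q)"
proof -
  define A where "A = {q. sublinear q \<and> (\<forall>v. q v \<le> p v)}"
  define P where "P = (\<lambda>(q::'a \<Rightarrow> real) r. \<forall>v. r v \<le> q v)"
  have po: "partial_order_on A (relation_of P A)"
  proof (rule partial_order_on_relation_ofI)
    show "P a c" if "P a b" "P b c" for a b c
      using that unfolding P_def by (blast intro: order_trans)
    show "a = b" if "P a b" "P b a" for a b
      using that unfolding P_def by (intro ext antisym) auto
  qed (simp add: P_def)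
  have "\<exists>m\<in>A. \<forall>a\<in>A. P m a \<longrightarrow> a = m"
  proof (rule predicate_Zorn[OF po])
    fix K assume "K \<in> Chains (relation_of P A)"
    then have KA: "K \<subseteq> A" and tot: "\<And>q r. q \<in> K \<Longrightarrow> r \<in> K \<Longrightarrow> P q r \<or> P r q"
      unfolding Chains_def relation_of_def by auto
    have sub: "sublinear q" and le_p: "q v \<le> p v" if "q \<in> K" for q v
      using that KA by (auto simp: A_def)
    show "\<exists>u\<in>A. \<forall>a\<in>K. P a u"
    proof (cases "K = {}")
      case True
      then show ?thesis using p by (auto simp: A_def)
    next
      case False
      define G where "G v = (\<lambda>q. q v) ` K" for v
      have bdd: "bdd_below (G v)" for v
      proof (rule bdd_belowI)
        fix a assume "a \<in> G v"
        then obtain q where "q \<in> K" "a = q v" by (auto simp: G_def)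
        then show "- p (- v) \<le> a"
          using sublinear_lower_bound[OF sub, of q v] le_p[of q "- v"] by simp
      qed
      have "sublinear (\<lambda>v. Inf (G v))"
      proof (rule sublinear_Inf)
        fix u v a b assume "a \<in> G u" "b \<in> G v"
        then obtain q r where qr: "q \<in> K" "r \<in> K" "a = q u" "b = r v" by (auto simp: G_def)
        \<comment> \<open>The smaller of two members of the chain bounds both.\<close>
        then obtain s where s: "s \<in> K" "s u \<le> a" "s v \<le> b"
          using tot[OF qr(1,2)] unfolding P_def by blast
        then have "s (u + v) \<le> a + b"
          using sublinear_add[OF sub[OF s(1)], of u v] by simp
        then show "\<exists>c\<in>G (u + v). c \<le> a + b" using s by (auto simp: G_def)
      next
        fix t :: real and v a assume "0 < t" "a \<in> G v"
        then show "\<exists>c\<in>G (t *\<^sub>R v). c \<le> t * a"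
          using sub by (auto simp: G_def sublinear_scale)
      qed (use False bdd in \<open>auto simp: G_def\<close>)
      moreover have low: "Inf (G v) \<le> q v" if "q \<in> K" for q v
        using that by (intro cInf_lower bdd) (auto simp: G_def)
      moreover have "Inf (G v) \<le> p v" for v
        using False low[of _ v] le_p[of _ v] by (meson equals0I order_trans)
      ultimately show ?thesis
        by (intro bexI[of _ "\<lambda>v. Inf (G v)"]) (auto simp: A_def P_def)
    qed
  qed
  then obtain m where m: "m \<in> A" "\<And>a. a \<in> A \<Longrightarrow> P m a \<Longrightarrow> a = m" by blast
  have "r = m" if "sublinear r" "\<forall>v. r v \<le> m v" for r
    using that m by (intro m(2)) (auto simp: A_def P_def intro: order_trans)
  then show ?thesis using m(1) by (auto simp: A_def)
qed

text \<open>A minimal \<open>q\<close> is superadditive: for fixed \<open>y\<close>, the infimum over \<open>t \<ge> 0\<close> of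
  \<open>q (v + t *\<^sub>R y) - t * q y\<close> is again sublinear in \<open>v\<close> and at most \<open>q v\<close>, so it equals \<open>q v\<close>; the choice
  \<open>t = 1\<close> then gives \<open>q v + q y \<le> q (v + y)\<close>.\<close>

lemma minimal_sublinear_imp_linear:
  assumes q: "sublinear q"
    and min: "\<And>r. sublinear r \<Longrightarrow> (\<And>v. r v \<le> q v) \<Longrightarrow> r = q"
  shows "linear q"
proof -
  have add: "q (v + y) = q v + q y" for v y
  proof -
    define G where "G v = (\<lambda>t. q (v + t *\<^sub>R y) - t * q y) ` {0..}" for v
    have bdd: "bdd_below (G v)" for v
    proof (rule bdd_belowI)
      fix a assume "a \<in> G v"
      then obtain t where t: "0 \<le> t" "a = q (v + t *\<^sub>R y) - t * q y" by (auto simp: G_def)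
      have "q (t *\<^sub>R y) \<le> q (v + t *\<^sub>R y) + q (- v)"
        using sublinear_add[OF q, of "v + t *\<^sub>R y" "- v"] by simp
      then show "- q (- v) \<le> a" using t by (simp add: sublinear_scale[OF q])
    qed
    have "sublinear (\<lambda>v. Inf (G v))"
    proof (rule sublinear_Inf)
      fix u v a b assume "a \<in> G u" "b \<in> G v"
      then obtain s t where st: "0 \<le> s" "0 \<le> t"
        "a = q (u + s *\<^sub>R y) - s * q y" "b = q (v + t *\<^sub>R y) - t * q y"
        by (auto simp: G_def)
      have "q ((u + v) + (s + t) *\<^sub>R y) \<le> q (u + s *\<^sub>R y) + q (v + t *\<^sub>R y)"
        using sublinear_add[OF q, of "u + s *\<^sub>R y" "v + t *\<^sub>R y"] by (simp add: algebra_simps)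
      then have "q ((u + v) + (s + t) *\<^sub>R y) - (s + t) * q y \<le> a + b"
        using st by (simp add: algebra_simps)
      then show "\<exists>c\<in>G (u + v). c \<le> a + b" using st by (auto simp: G_def)
    next
      fix s :: real and v a assume s: "0 < s" and "a \<in> G v"
      then obtain t where t: "0 \<le> t" "a = q (v + t *\<^sub>R y) - t * q y" by (auto simp: G_def)
      have "q (s *\<^sub>R v + (s * t) *\<^sub>R y) = s * q (v + t *\<^sub>R y)"
        using s sublinear_scale[OF q, of s "v + t *\<^sub>R y"] by (simp add: algebra_simps)
      then have "q (s *\<^sub>R v + (s * t) *\<^sub>R y) - (s * t) * q y = s * a"
        by (simp add: t(2) right_diff_distrib)
      then show "\<exists>c\<in>G (s *\<^sub>R v). c \<le> s * a"
        using s t by (intro bexI[of _ "s * a"]) (auto simp: G_def intro!: image_eqI[of _ _ "s * t"])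
    qed (use bdd in \<open>auto simp: G_def\<close>)
    moreover have "Inf (G v) \<le> q v" for v
      by (intro cInf_lower bdd) (auto simp: G_def intro!: image_eqI[of _ _ 0])
    ultimately have "(\<lambda>v. Inf (G v)) = q" by (rule min)
    then have "q v = Inf (G v)" by metis
    also have "\<dots> \<le> q (v + y) - q y"
      by (intro cInf_lower bdd) (auto simp: G_def intro!: image_eqI[of _ _ 1])
    finally show ?thesis using sublinear_add[OF q, of v y] by simp
  qed
  have minus: "q (- v) = - q v" for v
    using add[of v "- v"] sublinear_zero[OF q] by simp
  have "q (t *\<^sub>R v) = t * q v" for t v
  proof (cases "0 \<le> t")
    case False
    then have "q ((- t) *\<^sub>R v) = - t * q v" by (intro sublinear_scale[OF q]) simp
    then show ?thesis using minus[of "t *\<^sub>R v"] by simp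
  qed (rule sublinear_scale[OF q])
  then show ?thesis using add by (intro linearI) auto
qed

lemma ex_linear_le_sublinear:
  assumes "sublinear p"
  shows "\<exists>f. linear f \<and> (\<forall>v. f v \<le> p v)"
  using ex_minimal_sublinear[OF assms] minimal_sublinear_imp_linear by metis

text \<open>Let \<open>a\<close> range over \<open>K - x\<close>. The infimum of \<open>norm (v - t *\<^sub>R a) - t * r\<close> over \<open>t \<ge> 0\<close> and \<open>a\<close> is
  sublinear in \<open>v\<close>, at most \<open>norm v\<close> and at most \<open>- r\<close> at every \<open>a\<close>. A linear functional below it
  is therefore bounded and at most \<open>- r\<close> on \<open>K - x\<close>.\<close>

lemma separate_point_from_convex:
  fixes x :: "'a::real_normed_vector"
  assumes K: "convex K" "K \<noteq> {}" and r: "\<And>k. k \<in> K \<Longrightarrow> r \<le> norm (k - x)"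
  shows "\<exists>f :: 'a \<Rightarrow>\<^sub>L real. \<forall>k\<in>K. blinfun_apply f k \<le> blinfun_apply f x - r"
proof -
  define G where "G v = {norm (v - t *\<^sub>R (k - x)) - t * r | t k. 0 \<le> t \<and> k \<in> K}" for v
  have GI: "norm (v - t *\<^sub>R (k - x)) - t * r \<in> G v" if "0 \<le> t" "k \<in> K" for v t k
    using that by (auto simp: G_def)
  obtain k0 where k0: "k0 \<in> K" using K by auto
  have bdd: "bdd_below (G v)" for v
  proof (rule bdd_belowI)
    fix a assume "a \<in> G v"
    then obtain t k where tk: "0 \<le> t" "k \<in> K" "a = norm (v - t *\<^sub>R (k - x)) - t * r"
      by (auto simp: G_def)
    have "t * r \<le> norm (t *\<^sub>R (k - x))" using tk r by (simp add: mult_left_mono)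
    also have "\<dots> \<le> norm v + norm (v - t *\<^sub>R (k - x))"
      using norm_triangle_ineq4[of v "v - t *\<^sub>R (k - x)"] by simp
    finally show "- norm v \<le> a" using tk by simp
  qed
  have "sublinear (\<lambda>v. Inf (G v))"
  proof (rule sublinear_Inf)
    fix u v a b assume "a \<in> G u" "b \<in> G v"
    then obtain s k t h where *: "0 \<le> s" "k \<in> K" "a = norm (u - s *\<^sub>R (k - x)) - s * r"
      "0 \<le> t" "h \<in> K" "b = norm (v - t *\<^sub>R (h - x)) - t * r"
      by (auto simp: G_def)
    \<comment> \<open>The sum of two multiples of elements of the convex set \<open>K - x\<close> is again such a multiple.\<close>
    obtain j where j: "j \<in> K" "(s + t) *\<^sub>R (j - x) = s *\<^sub>R (k - x) + t *\<^sub>R (h - x)"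
    proof (cases "s + t = 0")
      case True
      then have "s = 0" "t = 0" using * by auto
      then show ?thesis using that[OF k0] by simp
    next
      case False
      define j where "j = (s / (s + t)) *\<^sub>R k + (t / (s + t)) *\<^sub>R h"
      have "s / (s + t) + t / (s + t) = 1" using False by (simp flip: add_divide_distrib)
      then have "j \<in> K" unfolding j_def using * K(1) by (intro convexD) auto
      moreover have "(s + t) *\<^sub>R j = s *\<^sub>R k + t *\<^sub>R h"
        using False by (simp add: j_def scaleR_add_right)
      then have "(s + t) *\<^sub>R (j - x) = s *\<^sub>R k + t *\<^sub>R h - (s + t) *\<^sub>R x"
        by (simp only: scaleR_diff_right)
      then have "(s + t) *\<^sub>R (j - x) = s *\<^sub>R (k - x) + t *\<^sub>R (h - x)"
        by (simp only: scaleR_diff_right scaleR_add_left) simp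
      ultimately show ?thesis using that by blast
    qed
    have "norm ((u + v) - (s + t) *\<^sub>R (j - x))
        \<le> norm (u - s *\<^sub>R (k - x)) + norm (v - t *\<^sub>R (h - x))"
      unfolding j(2) using norm_triangle_ineq[of "u - s *\<^sub>R (k - x)" "v - t *\<^sub>R (h - x)"]
      by (simp add: algebra_simps)
    then have "norm ((u + v) - (s + t) *\<^sub>R (j - x)) - (s + t) * r \<le> a + b"
      using * by (simp add: algebra_simps)
    moreover have "norm ((u + v) - (s + t) *\<^sub>R (j - x)) - (s + t) * r \<in> G (u + v)"
      using * j by (intro GI) auto
    ultimately show "\<exists>c\<in>G (u + v). c \<le> a + b" by blast
  next
    fix s :: real and v a assume s: "0 < s" and "a \<in> G v"
    then obtain t k where tk: "0 \<le> t" "k \<in> K" "a = norm (v - t *\<^sub>R (k - x)) - t * r"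
      by (auto simp: G_def)
    have "s *\<^sub>R v - (s * t) *\<^sub>R (k - x) = s *\<^sub>R (v - t *\<^sub>R (k - x))"
      by (simp add: scaleR_diff_right)
    then have "norm (s *\<^sub>R v - (s * t) *\<^sub>R (k - x)) = s * norm (v - t *\<^sub>R (k - x))"
      using s by simp
    then have "norm (s *\<^sub>R v - (s * t) *\<^sub>R (k - x)) - (s * t) * r = s * a"
      by (simp only: tk(3) right_diff_distrib mult.assoc)
    moreover have "norm (s *\<^sub>R v - (s * t) *\<^sub>R (k - x)) - (s * t) * r \<in> G (s *\<^sub>R v)"
      using s tk by (intro GI) auto
    ultimately show "\<exists>c\<in>G (s *\<^sub>R v). c \<le> s * a" by auto
  qed (use bdd GI[OF order_refl k0] in auto)
  then obtain f where f: "linear f" "\<And>v. f v \<le> Inf (G v)"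
    using ex_linear_le_sublinear by blast
  have fn: "f v \<le> norm v" for v
  proof -
    have "norm v \<in> G v" using GI[OF order_refl k0, of v] by simp
    then show ?thesis using f(2)[of v] cInf_lower[OF _ bdd] by (meson order_trans)
  qed
  have "\<bar>f v\<bar> \<le> norm v" for v
    using fn[of v] fn[of "- v"] linear_neg[OF f(1), of v] by simp
  then have "bounded_linear f"
    using f(1) by (intro bounded_linear_intro[where K = 1])
      (auto simp: linear_add linear_scale)
  then have app: "blinfun_apply (Blinfun f) = f" by (rule bounded_linear_Blinfun_apply)
  have "f k \<le> f x - r" if "k \<in> K" for k
  proof -
    have "- r \<in> G (k - x)" using GI[of 1 k "k - x"] that by simp
    then have "f (k - x) \<le> - r" using f(2)[of "k - x"] cInf_lower[OF _ bdd] by (meson order_trans)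
    then show ?thesis using linear_diff[OF f(1), of k x] by simp
  qed
  then show ?thesis using app by (intro exI[of _ "Blinfun f"]) simp
qed

section \<open>Basic weak neighbourhoods\<close>

text \<open>Half-spaces suffice as a subbasis at a point because a neighbourhood of \<open>f x\<close> in the reals is
  cut out by one condition on \<open>f\<close> and one on \<open>- f\<close>.\<close>

lemma openin_weak_topology_halfspaces:
  fixes x :: "'a::real_normed_vector"
  assumes "openin weak_topology W" "x \<in> W"
  shows "\<exists>F :: ('a \<Rightarrow>\<^sub>L real) set. \<exists>\<eta>>0. finite F \<and>
    {y. \<forall>f\<in>F. blinfun_apply f y < blinfun_apply f x + \<eta>} \<subseteq> W"
proof -
  have "generate_topology_on {blinfun_apply f -` U | (f :: 'a \<Rightarrow>\<^sub>L real) U. open U} W"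
    using assms(1) by (simp add: weak_topology_def openin_topology_generated_by_iff)
  then show ?thesis using assms(2)
  proof induction
    case Empty
    then show ?case by simp
  next
    case (Int a b)
    then obtain F G :: "('a \<Rightarrow>\<^sub>L real) set" and \<eta> \<theta> where *: "\<eta> > 0" "finite F" "\<theta> > 0" "finite G"
      "{y. \<forall>f\<in>F. blinfun_apply f y < blinfun_apply f x + \<eta>} \<subseteq> a"
      "{y. \<forall>f\<in>G. blinfun_apply f y < blinfun_apply f x + \<theta>} \<subseteq> b"
      by auto
    have "{y. \<forall>f\<in>F \<union> G. blinfun_apply f y < blinfun_apply f x + min \<eta> \<theta>} \<subseteq>
        {y. \<forall>f\<in>F. blinfun_apply f y < blinfun_apply f x + \<eta>} \<inter>
        {y. \<forall>f\<in>G. blinfun_apply f y < blinfun_apply f x + \<theta>}"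
      by force
    then have "{y. \<forall>f\<in>F \<union> G. blinfun_apply f y < blinfun_apply f x + min \<eta> \<theta>} \<subseteq> a \<inter> b"
      using * by blast
    then show ?case using * by (intro exI[of _ "F \<union> G"] exI[of _ "min \<eta> \<theta>"]) auto
  next
    case (UN K)
    then obtain k where "k \<in> K" "x \<in> k" by auto
    with UN(2)[OF this] show ?case by (meson Union_upper order_trans)
  next
    case (Basis s)
    then obtain f :: "'a \<Rightarrow>\<^sub>L real" and U where s: "s = blinfun_apply f -` U" "open U" by auto
    with Basis obtain e where e: "e > 0" "ball (blinfun_apply f x) e \<subseteq> U"
      by (auto elim: openE)
    have "y \<in> s" if "\<forall>g\<in>{f, - f}. blinfun_apply g y < blinfun_apply g x + e" for y
    proof -
      have "\<bar>blinfun_apply f x - blinfun_apply f y\<bar> < e"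
        using that by (auto simp: blinfun.minus_left)
      then show ?thesis using e s by (auto simp: dist_real_def)
    qed
    then show ?case using e by (intro exI[of _ "{f, - f}"] exI[of _ e]) auto
  qed
qed

lemma openin_weak_topology_vimage:
  fixes f :: "'a::real_normed_vector \<Rightarrow>\<^sub>L real"
  shows "open U \<Longrightarrow> openin weak_topology (blinfun_apply f -` U)"
  unfolding weak_topology_def by (rule topology_generated_by_Basis) auto

lemma openin_weak_topology_halfspace:
  fixes f :: "'a::real_normed_vector \<Rightarrow>\<^sub>L real"
  shows "openin weak_topology {y. blinfun_apply f y < a}"
  using openin_weak_topology_vimage[OF open_lessThan, of f a] by (simp add: vimage_def)

lemma topspace_weak_topology [simp]: "topspace weak_topology = UNIV"
  using openin_subset[OF openin_weak_topology_vimage[OF open_UNIV]] by auto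

lemma weak_to_norm_continuous_at_iff:
  fixes B :: "'a::real_normed_vector set"
  assumes x: "x \<in> B"
  shows "weak_to_norm_continuous_at B \<Phi> x \<longleftrightarrow>
    (\<forall>\<epsilon>>0. \<exists>F :: ('a \<Rightarrow>\<^sub>L real) set. \<exists>\<eta>>0. finite F \<and>
      (\<forall>y\<in>B. (\<forall>f\<in>F. blinfun_apply f y < blinfun_apply f x + \<eta>) \<longrightarrow> norm (\<Phi> x - \<Phi> y) < \<epsilon>))"
    (is "_ \<longleftrightarrow> ?R")
proof
  assume L: "weak_to_norm_continuous_at B \<Phi> x"
  show ?R
  proof (intro allI impI)
    fix \<epsilon> :: real assume "\<epsilon> > 0"
    then have "open (ball (\<Phi> x) \<epsilon>)" "\<Phi> x \<in> ball (\<Phi> x) \<epsilon>" by auto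
    then obtain U where U: "openin (subtopology weak_topology B) U" "x \<in> U"
      "\<And>y. y \<in> U \<Longrightarrow> \<Phi> y \<in> ball (\<Phi> x) \<epsilon>"
      using L unfolding weak_to_norm_continuous_at_def topcontinuous_at_def
      by (metis open_openin)
    then obtain W where W: "openin weak_topology W" "U = W \<inter> B"
      by (auto simp: openin_subtopology)
    with U obtain F :: "('a \<Rightarrow>\<^sub>L real) set" and \<eta> where F: "\<eta> > 0" "finite F"
      "{y. \<forall>f\<in>F. blinfun_apply f y < blinfun_apply f x + \<eta>} \<subseteq> W"
      using openin_weak_topology_halfspaces[of W x] by auto
    then have "norm (\<Phi> x - \<Phi> y) < \<epsilon>"
      if "y \<in> B" "\<forall>f\<in>F. blinfun_apply f y < blinfun_apply f x + \<eta>" for y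
      using U(3)[of y] W that by (auto simp: dist_norm)
    then show "\<exists>F :: ('a \<Rightarrow>\<^sub>L real) set. \<exists>\<eta>>0. finite F \<and>
      (\<forall>y\<in>B. (\<forall>f\<in>F. blinfun_apply f y < blinfun_apply f x + \<eta>) \<longrightarrow> norm (\<Phi> x - \<Phi> y) < \<epsilon>)"
      using F by blast
  qed
next
  assume R: ?R
  have "\<exists>U. openin (subtopology weak_topology B) U \<and> x \<in> U \<and> (\<forall>y\<in>U. \<Phi> y \<in> V)"
    if V: "open V" "\<Phi> x \<in> V" for V
  proof -
    obtain \<epsilon> where e: "\<epsilon> > 0" "ball (\<Phi> x) \<epsilon> \<subseteq> V" using V openE by blast
    then obtain F :: "('a \<Rightarrow>\<^sub>L real) set" and \<eta> where F: "\<eta> > 0" "finite F"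
      "\<And>y. y \<in> B \<Longrightarrow> \<forall>f\<in>F. blinfun_apply f y < blinfun_apply f x + \<eta> \<Longrightarrow> norm (\<Phi> x - \<Phi> y) < \<epsilon>"
      using R by meson
    define W where "W = (\<Inter>f\<in>F. {y. blinfun_apply f y < blinfun_apply f x + \<eta>})"
    have "openin weak_topology W"
    proof (cases "F = {}")
      case True
      then have "W = topspace weak_topology" by (simp add: W_def)
      then show ?thesis by (metis openin_topspace)
    next
      case False
      then show ?thesis unfolding W_def using F(2)
        by (intro openin_Inter) (auto intro: openin_weak_topology_halfspace)
    qed
    then have "openin (subtopology weak_topology B) (W \<inter> B)"
      by (auto simp: openin_subtopology)
    moreover have "x \<in> W \<inter> B" using x F(1) by (simp add: W_def)
    moreover have "\<Phi> y \<in> V" if "y \<in> W \<inter> B" for y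
      using F(3)[of y] that e(2) by (auto simp: W_def dist_norm)
    ultimately show ?thesis by blast
  qed
  then show "weak_to_norm_continuous_at B \<Phi> x"
    using x unfolding weak_to_norm_continuous_at_def topcontinuous_at_def
    by (auto simp flip: open_openin)
qed

section \<open>Convex combinations near a strongly extreme point\<close>

lemma strongly_extreme_midpoint:
  assumes "strongly_extreme B x" "\<epsilon> > 0"
  shows "\<exists>\<delta>>0. \<forall>y\<in>B. \<forall>z\<in>B. norm (x - (1/2) *\<^sub>R (y + z)) < \<delta> \<longrightarrow> norm (y - z) < \<epsilon>"
proof (rule ccontr)
  assume *: "\<not> ?thesis"
  have "\<exists>y z. y \<in> B \<and> z \<in> B \<and> norm (x - (1/2) *\<^sub>R (y + z)) < 1 / real (Suc n) \<and> \<not> norm (y - z) < \<epsilon>"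
    for n
    using * of_nat_0_less_iff[of "Suc n"] by (meson zero_less_Suc zero_less_divide_1_iff)
  then obtain y z where yz: "\<And>n. y n \<in> B" "\<And>n. z n \<in> B"
    "\<And>n. norm (x - (1/2) *\<^sub>R (y n + z n)) < 1 / real (Suc n)" "\<And>n. \<not> norm (y n - z n) < \<epsilon>"
    by metis
  have "(\<lambda>n. norm (x - (1/2) *\<^sub>R (y n + z n))) \<longlonglongrightarrow> 0"
  proof (rule Lim_null_comparison)
    show "\<forall>\<^sub>F n in sequentially. norm (norm (x - (1/2) *\<^sub>R (y n + z n))) \<le> 1 / real (Suc n)"
      using yz(3) by (intro always_eventually) (simp add: less_imp_le del: of_nat_Suc)
    show "(\<lambda>n. 1 / real (Suc n)) \<longlonglongrightarrow> 0"
      using LIMSEQ_inverse_real_of_nat by (simp add: inverse_eq_divide)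
  qed
  then have "(\<lambda>n. norm (y n - z n)) \<longlonglongrightarrow> 0"
    using assms(1) yz(1,2) unfolding strongly_extreme_def by blast
  then have "\<forall>\<^sub>F n in sequentially. norm (y n - z n) < \<epsilon>"
    using assms(2) by (rule order_tendstoD(2))
  then show False using yz(4) by simp
qed

text \<open>A convex combination is the midpoint of the point of weight at least \<open>1/2\<close> and another point
  of \<open>B\<close>. The distance between these two is a multiple of \<open>norm (c - d)\<close>, with factor \<open>2 * (1 - t)\<close> or
  \<open>2 * t\<close>. The first factor is the one needed to compare \<open>c\<close> with the combination; in the second case
  the lower bound on \<open>t\<close> serves to recover \<open>norm (c - d)\<close>.\<close>

lemma strongly_extreme_convex_combination:
  assumes x: "strongly_extreme B x" and B: "convex B" and \<epsilon>: "\<epsilon> > 0" and \<tau>: "0 < \<tau>" "\<tau> \<le> 1"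
  shows "\<exists>\<delta>>0. \<forall>c\<in>B. \<forall>d\<in>B. \<forall>t. \<tau> \<le> t \<and> t \<le> 1 \<and> norm (x - (t *\<^sub>R c + (1 - t) *\<^sub>R d)) < \<delta>
    \<longrightarrow> norm (c - x) < \<epsilon>"
proof -
  obtain \<delta> where \<delta>: "\<delta> > 0"
    "\<And>y z. y \<in> B \<Longrightarrow> z \<in> B \<Longrightarrow> norm (x - (1/2) *\<^sub>R (y + z)) < \<delta> \<Longrightarrow> norm (y - z) < \<tau> * \<epsilon>"
    using strongly_extreme_midpoint[OF x, of "\<tau> * \<epsilon>"] \<epsilon> \<tau> by (metis mult_pos_pos)
  have \<tau>\<epsilon>: "\<tau> * \<epsilon> \<le> \<epsilon>" using \<epsilon> \<tau> by simp
  have "norm (c - x) < \<epsilon>" if cd: "c \<in> B" "d \<in> B" and t: "\<tau> \<le> t" "t \<le> 1"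
    and close: "norm (x - (t *\<^sub>R c + (1 - t) *\<^sub>R d)) < min \<delta> (\<epsilon> / 2)" for c d t
  proof -
    define p where "p = t *\<^sub>R c + (1 - t) *\<^sub>R d"
    have cp: "c - p = (1 - t) *\<^sub>R (c - d)" by (simp add: p_def algebra_simps)
    have "norm (c - p) \<le> \<epsilon> / 2"
    proof (cases "t \<ge> 1/2")
      case True
      define e where "e = (2 * t - 1) *\<^sub>R c + (2 * (1 - t)) *\<^sub>R d"
      have e: "e \<in> B" unfolding e_def using cd t True B by (intro convexD) auto
      have "(1/2) *\<^sub>R (c + e) = p" by (simp add: e_def p_def algebra_simps)
      then have "norm (c - e) < \<tau> * \<epsilon>" using close by (intro \<delta>(2) cd e) (auto simp: p_def)
      moreover have "c - e = 2 *\<^sub>R (c - p)" by (simp add: e_def p_def algebra_simps scaleR_2)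
      ultimately show ?thesis using \<tau>\<epsilon> by simp
    next
      case False
      define e where "e = (2 * t) *\<^sub>R c + (1 - 2 * t) *\<^sub>R d"
      have e: "e \<in> B" unfolding e_def using cd t False \<tau> B by (intro convexD) auto
      have "(1/2) *\<^sub>R (d + e) = p"
        by (simp add: e_def p_def algebra_simps) (simp flip: scaleR_add_left)
      then have "norm (d - e) < \<tau> * \<epsilon>" using close by (intro \<delta>(2) cd e) (auto simp: p_def)
      moreover have "norm (d - e) = 2 * t * norm (c - d)"
      proof -
        have "d - e = - ((2 * t) *\<^sub>R (c - d))" by (simp add: e_def algebra_simps)
        then show ?thesis using t \<tau> by (simp del: scaleR_scaleR)
      qed
      moreover have "\<tau> * norm (c - d) \<le> t * norm (c - d)" using t by (simp add: mult_right_mono)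
      ultimately have "\<tau> * (2 * norm (c - d)) < \<tau> * \<epsilon>" by simp
      then have "norm (c - d) \<le> \<epsilon> / 2" using \<tau> by simp
      moreover have "norm (c - p) \<le> norm (c - d)"
        using t \<tau> unfolding cp by (simp add: mult_left_le_one_le)
      ultimately show ?thesis by simp
    qed
    moreover have "norm (p - x) < \<epsilon> / 2" using close by (simp add: p_def norm_minus_commute)
    moreover have "norm (c - x) \<le> norm (c - p) + norm (p - x)"
      using norm_triangle_ineq[of "c - p" "p - x"] by simp
    ultimately show ?thesis by simp
  qed
  then show ?thesis using \<delta>(1) \<epsilon> by (intro exI[of _ "min \<delta> (\<epsilon> / 2)"]) auto
qed

text \<open>In a convex combination of two points one weight is at least \<open>1/2\<close>, so if points of the convex
  hull came arbitrarily close to \<open>x\<close>, then so would points of \<open>K\<close> or of \<open>E\<close>.\<close>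

lemma strongly_extreme_avoids_join:
  assumes x: "strongly_extreme B x" and B: "convex B"
    and K: "convex K" "K \<subseteq> B" and E: "convex E" "E \<subseteq> B"
    and r: "r > 0" "\<And>k. k \<in> K \<Longrightarrow> r \<le> norm (k - x)" "\<And>k. k \<in> E \<Longrightarrow> r \<le> norm (k - x)"
  shows "\<exists>\<delta>>0. \<forall>p\<in>convex hull (K \<union> E). \<delta> \<le> norm (p - x)"
proof -
  obtain \<delta> where \<delta>: "\<delta> > 0" "\<And>c d t. c \<in> B \<Longrightarrow> d \<in> B \<Longrightarrow> 1/2 \<le> t \<Longrightarrow> t \<le> 1 \<Longrightarrow>
      norm (x - (t *\<^sub>R c + (1 - t) *\<^sub>R d)) < \<delta> \<Longrightarrow> norm (c - x) < r"
    using strongly_extreme_convex_combination[OF x B r(1), of "1/2"] by auto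
  have "\<delta> \<le> norm (p - x)" if p: "p \<in> convex hull (K \<union> E)" and ne: "K \<noteq> {}" "E \<noteq> {}" for p
  proof (rule ccontr)
    assume "\<not> \<delta> \<le> norm (p - x)"
    then have close: "norm (x - p) < \<delta>" by (simp add: norm_minus_commute)
    have "p \<in> convex hull \<Union> ((\<lambda>b. if b then K else E) ` UNIV)"
      using p by (simp add: UNIV_bool Un_commute)
    then obtain u :: "bool \<Rightarrow> real" and s :: "bool \<Rightarrow> 'a" where "\<forall>b\<in>UNIV. 0 \<le> u b"
      "sum u UNIV = 1" "\<forall>b\<in>UNIV. s b \<in> (if b then K else E)" "p = (\<Sum>b\<in>UNIV. u b *\<^sub>R s b)"
      using K E ne by (subst (asm) convex_hull_finite_union) auto
    then have us: "0 \<le> u True \<and> 0 \<le> u False" "u True + u False = 1" "s True \<in> K" "s False \<in> E"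
      "p = u True *\<^sub>R s True + u False *\<^sub>R s False"
      by (auto simp: UNIV_bool add.commute)
    show False
    proof (cases "u True \<ge> 1/2")
      case True
      have u: "u False = 1 - u True" using us(2) by simp
      have "norm (s True - x) < r"
      proof (rule \<delta>(2))
        show "norm (x - (u True *\<^sub>R s True + (1 - u True) *\<^sub>R s False)) < \<delta>"
          using close unfolding us(5) u .
      qed (use us True K(2) E(2) in auto)
      then show False using r(2)[OF us(3)] by simp
    next
      case False
      have u: "u True = 1 - u False" using us(2) by simp
      have "norm (s False - x) < r"
      proof (rule \<delta>(2))
        show "norm (x - (u False *\<^sub>R s False + (1 - u False) *\<^sub>R s True)) < \<delta>"
          using close unfolding us(5) u by (simp add: add.commute)
      qed (use us False K(2) E(2) in auto)
      then show False using r(3)[OF us(4)] by simp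
    qed
  qed
  moreover have "convex hull (K \<union> E) = K \<union> E" if "K = {} \<or> E = {}"
    using that K E by (auto simp: hull_same)
  ultimately show ?thesis
  proof (cases "K = {} \<or> E = {}")
    case True
    with \<open>K = {} \<or> E = {} \<Longrightarrow> convex hull (K \<union> E) = K \<union> E\<close> show ?thesis using r by (metis Un_iff)
  qed (use \<delta>(1) in blast)
qed

text \<open>By continuity each half-space stays away from \<open>x\<close>; they are joined one at a time, so that every
  step is a join of two convex sets.\<close>

lemma strongly_extreme_avoids_hull_of_halfspaces:
  fixes F :: "('a::real_normed_vector \<Rightarrow>\<^sub>L real) set"
  assumes x: "strongly_extreme B x" and B: "convex B" and \<eta>: "\<eta> > 0" and F: "finite F"
  shows "\<exists>\<delta>>0. \<forall>p\<in>convex hull {y\<in>B. \<exists>f\<in>F. blinfun_apply f y \<ge> blinfun_apply f x + \<eta>}.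
    \<delta> \<le> norm (p - x)"
  using F
proof induction
  case empty
  then show ?case by (auto intro: exI[of _ 1])
next
  case (insert g F)
  let ?D = "\<lambda>F. {y\<in>B. \<exists>f\<in>F. blinfun_apply f y \<ge> blinfun_apply f x + \<eta>}"
  obtain r where r: "r > 0" "\<And>p. p \<in> convex hull ?D F \<Longrightarrow> r \<le> norm (p - x)"
    using insert.IH by blast
  define E where "E = {y\<in>B. blinfun_apply g y \<ge> blinfun_apply g x + \<eta>}"
  have E: "convex E" "E \<subseteq> B"
  proof -
    have "convex {y. blinfun_apply g y \<ge> blinfun_apply g x + \<eta>}"
      using convex_linear_vimage[of g "{blinfun_apply g x + \<eta>..}"]
      by (simp add: vimage_def blinfun.bounded_linear_right bounded_linear.linear)
    from convex_Int[OF B this] show "convex E" by (simp add: E_def Int_def)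
  qed (auto simp: E_def)
  have "continuous (at x) (blinfun_apply g)"
    by (rule linear_continuous_at[OF blinfun.bounded_linear_right])
  then obtain s where s: "s > 0"
    "\<And>y. dist y x < s \<Longrightarrow> dist (blinfun_apply g y) (blinfun_apply g x) < \<eta>"
    using \<eta> unfolding continuous_at_eps_delta by (auto simp: dist_norm)
  have Es: "s \<le> norm (y - x)" if "y \<in> E" for y
    using s(2)[of y] that by (force simp: E_def dist_norm)
  have "convex hull ?D F \<subseteq> B" using B by (intro hull_minimal) auto
  then obtain \<delta> where \<delta>: "\<delta> > 0" "\<And>p. p \<in> convex hull (convex hull ?D F \<union> E) \<Longrightarrow> \<delta> \<le> norm (p - x)"
    using strongly_extreme_avoids_join[OF x B convex_convex_hull _ E, of "?D F" "min r s"] r s Es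
    by (auto simp: min_le_iff_disj)
  have "?D (insert g F) \<subseteq> convex hull ?D F \<union> E"
    using hull_subset[of "?D F" convex] by (auto simp: E_def)
  then have "convex hull ?D (insert g F) \<subseteq> convex hull (convex hull ?D F \<union> E)"
    by (rule hull_mono)
  then show ?case using \<delta> by blast
qed

section \<open>Denting points\<close>

lemma denting_pointI:
  fixes B :: "'a::real_normed_vector set"
  assumes x: "x \<in> B" and B: "bounded B"
    and ex: "\<And>\<epsilon>. \<epsilon> > 0 \<Longrightarrow> \<exists>(f :: 'a \<Rightarrow>\<^sub>L real) a. a < blinfun_apply f x \<and> f \<noteq> 0 \<and>
      (\<forall>y\<in>B. a < blinfun_apply f y \<longrightarrow> norm (x - y) < \<epsilon>)"
  shows "denting_point B x"
  unfolding denting_point_def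
proof (intro conjI allI impI)
  fix \<epsilon> \<delta> :: real assume \<epsilon>: "\<epsilon> > 0" and \<delta>: "\<delta> > 0"
  from \<epsilon> have "\<epsilon> / 4 > 0" by simp
  from ex[OF this] obtain f :: "'a \<Rightarrow>\<^sub>L real" and a where f: "a < blinfun_apply f x" "f \<noteq> 0"
    "\<And>y. y \<in> B \<Longrightarrow> a < blinfun_apply f y \<Longrightarrow> norm (x - y) < \<epsilon> / 4"
    by blast
  define M where "M = (SUP z\<in>B. blinfun_apply f z)"
  have bdd: "bdd_above (blinfun_apply f ` B)"
    using bounded_linear_image[OF B blinfun.bounded_linear_right[of f]]
    by (rule bounded_imp_bdd_above)
  have fxM: "blinfun_apply f x \<le> M" unfolding M_def by (rule cSUP_upper[OF x bdd])
  \<comment> \<open>The width of a slice is prescribed, but rescaling \<open>f\<close> turns the width \<open>M - a\<close> into \<open>\<delta>\<close>.\<close>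
  define c where "c = \<delta> / (M - a)"
  have c: "c > 0" "c * (M - a) = \<delta>" using fxM f(1) \<delta> by (auto simp: c_def)
  have "(SUP z\<in>B. blinfun_apply (c *\<^sub>R f) z) = c * M"
  proof (rule cSup_eq_non_empty)
    show "blinfun_apply (c *\<^sub>R f) ` B \<noteq> {}" using x by auto
    show "y \<le> c * M" if y: "y \<in> blinfun_apply (c *\<^sub>R f) ` B" for y
    proof -
      obtain z where z: "z \<in> B" "y = c * blinfun_apply f z"
        using y by (auto simp: blinfun.scaleR_left)
      have "blinfun_apply f z \<le> M" unfolding M_def by (rule cSUP_upper[OF z(1) bdd])
      then show ?thesis using c(1) z(2) by simp
    qed
    show "c * M \<le> s" if "\<And>y. y \<in> blinfun_apply (c *\<^sub>R f) ` B \<Longrightarrow> y \<le> s" for s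
    proof -
      have "M \<le> s / c" unfolding M_def
      proof (rule cSUP_least)
        fix z assume "z \<in> B"
        then have "blinfun_apply (c *\<^sub>R f) z \<le> s" by (intro that imageI)
        then show "blinfun_apply f z \<le> s / c" using c(1) by (simp add: blinfun.scaleR_left field_simps)
      qed (use x in auto)
      then show ?thesis using c(1) by (simp add: field_simps)
    qed
  qed
  moreover have "c * M - \<delta> = c * a" using c(2) by (simp add: algebra_simps)
  ultimately have sl: "slice B (c *\<^sub>R f) \<delta> = {y\<in>B. a < blinfun_apply f y}"
    using c(1) by (simp add: slice_def blinfun.scaleR_left)
  have "diameter (slice B (c *\<^sub>R f) \<delta>) \<le> \<epsilon> / 2"
  proof (rule diameter_le)
    fix y z assume "y \<in> slice B (c *\<^sub>R f) \<delta>" "z \<in> slice B (c *\<^sub>R f) \<delta>"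
    then have "norm (x - y) < \<epsilon> / 4" "norm (x - z) < \<epsilon> / 4" using f(3) by (auto simp: sl)
    then show "norm (y - z) \<le> \<epsilon> / 2"
      using norm_triangle_ineq4[of "x - z" "x - y"] by simp
  qed (use \<epsilon> in auto)
  then show "\<exists>f. f \<noteq> 0 \<and> x \<in> slice B f \<delta> \<and> diameter (slice B f \<delta>) < \<epsilon>"
    using f(1,2) x c(1) \<epsilon> by (intro exI[of _ "c *\<^sub>R f"] conjI) (simp_all add: sl)
qed (rule x)

text \<open>A basic weak neighbourhood that is small in norm omits a part of \<open>B\<close> whose convex hull has
  positive distance from \<open>x\<close>; a functional separating \<open>x\<close> from the hull defines a slice inside the
  neighbourhood.\<close>

lemma strongly_extreme_imp_denting_point:
  fixes B :: "'a::real_normed_vector set"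
  assumes nontrivial: "\<exists>v::'a. v \<noteq> 0"
    and x: "strongly_extreme B x" and B: "convex B" "bounded B"
    and pc: "weak_to_norm_continuous_at B (\<lambda>y. y) x"
  shows "denting_point B x"
proof -
  have xB: "x \<in> B" using x by (simp add: strongly_extreme_def)
  show ?thesis
  proof (rule denting_pointI[OF xB B(2)])
    fix \<epsilon> :: real assume "\<epsilon> > 0"
    then obtain F :: "('a \<Rightarrow>\<^sub>L real) set" and \<eta> where F: "\<eta> > 0" "finite F" and
      near: "\<And>y. y \<in> B \<Longrightarrow> \<forall>f\<in>F. blinfun_apply f y < blinfun_apply f x + \<eta> \<Longrightarrow> norm (x - y) < \<epsilon>"
      using pc weak_to_norm_continuous_at_iff[OF xB, of "\<lambda>y. y"] by meson
    define D where "D = {y\<in>B. \<exists>f\<in>F. blinfun_apply f y \<ge> blinfun_apply f x + \<eta>}"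
    obtain r where r: "r > 0" "\<And>p. p \<in> convex hull D \<Longrightarrow> r \<le> norm (p - x)"
      using strongly_extreme_avoids_hull_of_halfspaces[OF x B(1) F] unfolding D_def by blast
    \<comment> \<open>If the neighbourhood contains all of \<open>B\<close>, any point other than \<open>x\<close> may play the role of the hull;
      it only ensures that the functional is nonzero.\<close>
    obtain K where K: "convex K" "K \<noteq> {}" "D \<subseteq> K"
      "\<exists>s>0. \<forall>p\<in>K. s \<le> norm (p - x)"
    proof (cases "D = {}")
      case True
      obtain v :: 'a where "v \<noteq> 0" using nontrivial by blast
      then show ?thesis using True by (intro that[of "{x + v}"]) (auto intro: exI[of _ "norm v"])
    next
      case False
      then show ?thesis using r hull_subset[of D convex]
        by (intro that[of "convex hull D"]) auto
    qed
    then obtain s where s: "s > 0" "\<And>p. p \<in> K \<Longrightarrow> s \<le> norm (p - x)" by blast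
    obtain f :: "'a \<Rightarrow>\<^sub>L real" where f: "\<And>k. k \<in> K \<Longrightarrow> blinfun_apply f k \<le> blinfun_apply f x - s"
      using separate_point_from_convex[OF K(1,2) s(2)] by blast
    have "f \<noteq> 0" using f K(2) s(1) by force
    moreover have "norm (x - y) < \<epsilon>" if "y \<in> B" "blinfun_apply f x - s < blinfun_apply f y" for y
    proof -
      have "y \<notin> D" using f[of y] K(3) that(2) by auto
      then show ?thesis using that(1) by (intro near) (auto simp: D_def not_le)
    qed
    ultimately show "\<exists>(f :: 'a \<Rightarrow>\<^sub>L real) a. a < blinfun_apply f x \<and> f \<noteq> 0 \<and>
        (\<forall>y\<in>B. a < blinfun_apply f y \<longrightarrow> norm (x - y) < \<epsilon>)"
      using s(1) by (intro exI[of _ f] exI[of _ "blinfun_apply f x - s"]) auto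
  qed
qed

section \<open>Weak to norm continuity of the identity\<close>

text \<open>Boundedness of \<open>C\<close> makes the supremum \<open>dist_sup C l \<Phi> x \<epsilon>\<close> an upper bound of the distances it
  collects; without it the real supremum carries no information.\<close>

lemma ex_close_point_of_dist_sup:
  assumes C: "bounded C" and y: "y \<in> C" "norm (\<Phi> x - \<Phi> y) \<le> \<epsilon>" and l: "l \<ge> 0"
    and s: "dist_sup C l \<Phi> x \<epsilon> < s"
  shows "\<exists>c\<in>C. norm ((1 + l) *\<^sub>R \<Phi> y - l *\<^sub>R y - c) < s"
proof -
  let ?g = "\<lambda>y. infdist ((1 + l) *\<^sub>R \<Phi> y - l *\<^sub>R y) C"
  let ?Y = "{y \<in> C. norm (\<Phi> x - \<Phi> y) \<le> \<epsilon>}"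
  obtain M where M: "\<And>z. z \<in> C \<Longrightarrow> norm z \<le> M" using C by (auto simp: bounded_iff)
  have "?g z \<le> (1 + l) * (norm (\<Phi> x) + \<epsilon>) + l * M + M" if z: "z \<in> ?Y" for z
  proof -
    have "norm (\<Phi> z) \<le> norm (\<Phi> x) + \<epsilon>"
      using z norm_triangle_ineq4[of "\<Phi> x" "\<Phi> x - \<Phi> z"] by simp
    then have 1: "(1 + l) * norm (\<Phi> z) \<le> (1 + l) * (norm (\<Phi> x) + \<epsilon>)"
      using l by (intro mult_left_mono) auto
    have 2: "l * norm z \<le> l * M" using l M z by (simp add: mult_left_mono)
    have "?g z \<le> norm ((1 + l) *\<^sub>R \<Phi> z - l *\<^sub>R z - y)"
      using infdist_le[OF y(1)] by (simp add: dist_norm)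
    also have "\<dots> \<le> norm ((1 + l) *\<^sub>R \<Phi> z) + norm (l *\<^sub>R z) + norm y"
      by (meson add_right_mono norm_triangle_ineq4 order_trans)
    also have "\<dots> = (1 + l) * norm (\<Phi> z) + l * norm z + norm y" using l by simp
    also have "\<dots> \<le> (1 + l) * (norm (\<Phi> x) + \<epsilon>) + l * M + M"
      using 1 2 M[OF y(1)] by simp
    finally show ?thesis .
  qed
  then have "bdd_above (?g ` ?Y)" by (intro bdd_aboveI2)
  then have "?g y \<le> dist_sup C l \<Phi> x \<epsilon>"
    unfolding dist_sup_def using y by (intro cSUP_upper) auto
  then have "(INF c\<in>C. dist ((1 + l) *\<^sub>R \<Phi> y - l *\<^sub>R y) c) < s"
    using s y(1) by (subst (asm) infdist_notempty) auto
  then show ?thesis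
    using y(1) by (subst (asm) cINF_less_iff) (auto simp: dist_norm intro: bdd_belowI2[of _ 0])
qed

text \<open>If \<open>(1 + l) *\<^sub>R \<Phi> n y - l *\<^sub>R y\<close> is close to \<open>c \<in> C\<close>, then \<open>\<Phi> n y\<close> is close to a convex
  combination of \<open>y\<close> and \<open>c\<close> in which \<open>y\<close> has the fixed weight \<open>l / (1 + l)\<close>. Weak closeness of \<open>y\<close> to
  \<open>x\<close> makes \<open>\<Phi> n y\<close> close to \<open>\<Phi> n x\<close>, hence to \<open>x\<close>, and strong extremality forces \<open>y\<close> towards \<open>x\<close>.\<close>

lemma weak_to_norm_continuous_at_ident:
  fixes C :: "'a::real_normed_vector set"
  assumes C: "bounded C" "convex C" and x: "strongly_extreme C x"
    and cont: "\<And>n. weak_to_norm_continuous_at C (\<Phi> n) x"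
    and \<Phi>x: "(\<lambda>n. norm (\<Phi> n x - x)) \<longlonglongrightarrow> 0"
    and l: "0 < l"
    and lim: "\<And>n. ((\<lambda>\<epsilon>. dist_sup C l (\<Phi> n) x \<epsilon>) \<longlongrightarrow> L n) (at_right 0)"
    and L: "L \<longlonglongrightarrow> 0"
  shows "weak_to_norm_continuous_at C (\<lambda>y. y) x"
proof -
  have xC: "x \<in> C" using x by (simp add: strongly_extreme_def)
  show ?thesis unfolding weak_to_norm_continuous_at_iff[OF xC]
  proof (intro allI impI)
    fix e :: real assume e: "e > 0"
    define \<tau> where "\<tau> = l / (1 + l)"
    have \<tau>: "0 < \<tau>" "\<tau> \<le> 1" "1 - \<tau> = 1 / (1 + l)" using l by (auto simp: \<tau>_def field_simps)
    obtain \<delta> where \<delta>: "\<delta> > 0" "\<And>c d. c \<in> C \<Longrightarrow> d \<in> C \<Longrightarrow>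
        norm (x - (\<tau> *\<^sub>R c + (1 - \<tau>) *\<^sub>R d)) < \<delta> \<Longrightarrow> norm (c - x) < e"
      using strongly_extreme_convex_combination[OF x C(2) e \<tau>(1,2)] \<tau>(2) by blast
    have "\<forall>\<^sub>F n in sequentially. norm (\<Phi> n x - x) < \<delta> / 3 \<and> L n < \<delta> / 3"
      using \<delta>(1) by (intro eventually_conj order_tendstoD(2)[OF \<Phi>x] order_tendstoD(2)[OF L]) auto
    then obtain n where n: "norm (\<Phi> n x - x) < \<delta> / 3" "L n < \<delta> / 3"
      using eventually_happens by force
    have "\<forall>\<^sub>F \<epsilon> in at_right 0. dist_sup C l (\<Phi> n) x \<epsilon> < \<delta> / 3 \<and> \<epsilon> \<in> {0<..<\<delta> / 3}"
      using \<delta>(1) n(2)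
      by (intro eventually_conj order_tendstoD(2)[OF lim] eventually_at_right_real) auto
    then obtain \<epsilon> where \<epsilon>: "dist_sup C l (\<Phi> n) x \<epsilon> < \<delta> / 3" "0 < \<epsilon>" "\<epsilon> < \<delta> / 3"
      using eventually_happens[of _ "at_right (0::real)"] by force
    obtain F :: "('a \<Rightarrow>\<^sub>L real) set" and \<eta> where F: "\<eta> > 0" "finite F"
      "\<And>y. y \<in> C \<Longrightarrow> \<forall>f\<in>F. blinfun_apply f y < blinfun_apply f x + \<eta> \<Longrightarrow> norm (\<Phi> n x - \<Phi> n y) < \<epsilon>"
      using cont[of n] weak_to_norm_continuous_at_iff[OF xC, of "\<Phi> n"] \<epsilon>(2) by meson
    have "norm (x - y) < e"
      if y: "y \<in> C" "\<forall>f\<in>F. blinfun_apply f y < blinfun_apply f x + \<eta>" for y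
    proof -
      have near: "norm (\<Phi> n x - \<Phi> n y) < \<epsilon>" using F(3)[OF y] .
      then obtain c where c: "c \<in> C" "norm ((1 + l) *\<^sub>R \<Phi> n y - l *\<^sub>R y - c) < \<delta> / 3"
        using ex_close_point_of_dist_sup[where \<Phi> = "\<Phi> n", OF C(1) y(1) _ _ \<epsilon>(1)] l by auto
      define w where "w = \<tau> *\<^sub>R y + (1 - \<tau>) *\<^sub>R c"
      have "\<Phi> n y - w = (1 - \<tau>) *\<^sub>R ((1 + l) *\<^sub>R \<Phi> n y - l *\<^sub>R y - c)"
        using l by (simp add: w_def \<tau>(3) scaleR_diff_right) (simp add: \<tau>_def)
      then have "norm (\<Phi> n y - w) \<le> norm ((1 + l) *\<^sub>R \<Phi> n y - l *\<^sub>R y - c)"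
        using \<tau>(1,2) by (simp add: mult_left_le_one_le)
      moreover have "norm (x - w)
          \<le> norm (\<Phi> n x - x) + norm (\<Phi> n x - \<Phi> n y) + norm (\<Phi> n y - w)"
        using norm_triangle_ineq[of "x - \<Phi> n x" "\<Phi> n x - \<Phi> n y"]
          norm_triangle_ineq[of "x - \<Phi> n y" "\<Phi> n y - w"]
        by (simp add: norm_minus_commute)
      ultimately have "norm (x - w) < \<delta>"
        using near n(1) \<epsilon>(3) c(2) by linarith
      then show ?thesis using \<delta>(2)[OF y(1) c(1)] by (simp add: w_def norm_minus_commute)
    qed
    then show "\<exists>F :: ('a \<Rightarrow>\<^sub>L real) set. \<exists>\<eta>>0. finite F \<and>
      (\<forall>y\<in>C. (\<forall>f\<in>F. blinfun_apply f y < blinfun_apply f x + \<eta>) \<longrightarrow> norm (x - y) < e)"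
      using F by blast
  qed
qed

section \<open>The denting point theorem\<close>

theorem theorem2p1:
  fixes C :: "'a::banach set" and x :: 'a
    and \<Phi> :: "nat \<Rightarrow> 'a \<Rightarrow> 'a" and l :: real and L :: "nat \<Rightarrow> real"
  assumes nontrivial: "\<exists>v::'a. v \<noteq> 0"
    and "C \<noteq> {}" and "bounded C" and "closed C" and "convex C"
    and "x \<in> C" and "strongly_extreme C x"
    and "\<And>n. weak_to_norm_continuous_at C (\<Phi> n) x"
    and "(\<lambda>n. norm (\<Phi> n x - x)) \<longlonglongrightarrow> 0"
    and "0 < l" and "l \<le> 1"
    and "\<And>n. ((\<lambda>\<epsilon>. dist_sup C l (\<Phi> n) x \<epsilon>) \<longlongrightarrow> L n) (at_right 0)"
    and "L \<longlonglongrightarrow> 0"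
  shows "denting_point C x"
proof (rule strongly_extreme_imp_denting_point[OF nontrivial])
  show "weak_to_norm_continuous_at C (\<lambda>y. y) x"
    using assms by (intro weak_to_norm_continuous_at_ident[of C x \<Phi> l L])
qed (use assms in auto)

end
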